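(* Let $X$ be a compact topological space and let $R$ be an orthogonality relation on $X$ that is closed in $X^2$. Then $R$ has bounded cliques; that is, there exists a natural number $n$ such that $|A| \leq n$ for every $R$-clique $A \subseteq X$.
   Context: An orthogonality relation on a set $X$ is a symmetric, irreflexive binary relation $R \subseteq X \times X$. An $R$-clique is a subset $A \subseteq X$ any two distinct points of which are $R$-related. Compact means that every open cover has a finite subcover; no separation axioms are assumed. $X^2$ carries the product topology. *)

theory Defs
  imports "HOL-Analysis.Analysis"
begin

definition orthogonality_relation :: "'a set \<Rightarrow> 'a rel \<Rightarrow> bool" where
  "orthogonality_relation S R \<longleftrightarrow> R \<subseteq> S \<times> S \<and> sym_on S R \<and> irrefl_on S R"

definition clique :: "'a set \<Rightarrow> 'a rel \<Rightarrow> 'a set \<Rightarrow> bool" where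
  "clique S R A \<longleftrightarrow> A \<subseteq> S \<and> pairwise (\<lambda>x y. (x, y) \<in> R) A"

(* card is 0 on infinite sets, so finiteness has to be required explicitly. *)
definition bounded_cliques :: "'a set \<Rightarrow> 'a rel \<Rightarrow> bool" where
  "bounded_cliques S R \<longleftrightarrow> (\<exists>n::nat. \<forall>A. clique S R A \<longrightarrow> finite A \<and> card A \<le> n)"

end

theory Submission
  imports Defs
begin

text \<open>
  As the complement of \<open>R\<close> is an open set containing the diagonal, every point has an open
  neighbourhood \<open>U\<close> with \<open>U \<times> U\<close> disjoint from \<open>R\<close>, and a clique has at most one point in
  such a \<open>U\<close>. Finitely many such neighbourhoods cover \<open>X\<close>, and their number bounds every clique.
\<close>

theorem lemma1:
  fixes X :: "'a topology" and R :: "'a rel"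
  assumes "compact_space X"
    and "orthogonality_relation (topspace X) R"
    and "closedin (prod_topology X X) R"
  shows "bounded_cliques (topspace X) R"
proof -
  define \<U> where "\<U> = {U. openin X U \<and> U \<times> U \<inter> R = {}}"
  have "topspace X \<subseteq> \<Union>\<U>"
  proof
    fix x assume x: "x \<in> topspace X"
    have "openin (prod_topology X X) (topspace X \<times> topspace X - R)"
      using assms(3) by (simp add: closedin_def)
    moreover have "(x, x) \<in> topspace X \<times> topspace X - R"
      using x assms(2) by (auto simp: orthogonality_relation_def irrefl_on_def)
    ultimately obtain U V where UV: "openin X U" "openin X V" "x \<in> U" "x \<in> V"
      "U \<times> V \<subseteq> topspace X \<times> topspace X - R"
      unfolding openin_prod_topology_alt by meson
    \<comment> \<open>The box around \<open>(x, x)\<close> may have different sides; shrinking both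
      to \<open>U \<inter> V\<close> leaves a square inside it that still contains
      \<open>(x, x)\<close>.\<close>
    then have "U \<inter> V \<in> \<U>"
      unfolding \<U>_def by blast
    with UV show "x \<in> \<Union>\<U>" by blast
  qed
  moreover have "\<forall>U\<in>\<U>. openin X U"
    by (simp add: \<U>_def)
  ultimately obtain \<F> where \<F>: "finite \<F>" "\<F> \<subseteq> \<U>" "topspace X \<subseteq> \<Union>\<F>"
    using assms(1) unfolding compact_space_alt by meson
  have "finite A \<and> card A \<le> card \<F>" if A: "clique (topspace X) R A" for A
  proof -
    have "\<forall>a\<in>A. \<exists>U\<in>\<F>. a \<in> U"
      using A \<F>(3) unfolding clique_def by blast
    then obtain f where f: "\<And>a. a \<in> A \<Longrightarrow> f a \<in> \<F> \<and> a \<in> f a"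
      by metis
    \<comment> \<open>Distinct points of \<open>A\<close> with a common value of \<open>f\<close>
      would form a pair of \<open>R\<close> inside a square that avoids \<open>R\<close>.\<close>
    have "inj_on f A"
    proof (rule inj_onI, rule ccontr)
      fix a b assume ab: "a \<in> A" "b \<in> A" "f a = f b" "a \<noteq> b"
      then have "(a, b) \<in> R"
        using A unfolding clique_def pairwise_def by blast
      moreover have "(a, b) \<in> f a \<times> f a"
        using ab f[of a] f[of b] by simp
      moreover have "f a \<times> f a \<inter> R = {}"
        using f[OF ab(1)] \<F>(2) unfolding \<U>_def by blast
      ultimately show False by blast
    qed
    moreover have "f ` A \<subseteq> \<F>"
      using f by blast
    \<comment> \<open>The injection into the finite \<open>\<F>\<close> also rules out an infinite
      \<open>A\<close>, whose \<open>card\<close> would be 0.\<close>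
    ultimately show ?thesis
      using \<F>(1) inj_on_finite card_inj_on_le by metis
  qed
  then show ?thesis
    unfolding bounded_cliques_def by blast
qed

end
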